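(* Let $P$ be the (Calabi–Rosenlicht, i.e. doubled) Prüfer surface. Then $P$, which is a separable non-metrizable manifold, does not have the homotopy type of a CW-complex; that is, there is no CW-complex homotopy equivalent to $P$.
   Context: A manifold is a Hausdorff topological space that is locally Euclidean (no second countability, paracompactness or metrizability is assumed). A space is separable if it has a countable dense subset. Construction of $P$. Let $\mathcal{H}=\{z\in\mathbb{C} : \operatorname{Im}(z)>0\}$ be the open upper half-plane. Let $P_0$ be the set consisting of the points of $\mathcal{H}$ together with all rays emanating from points of $\mathbb{R}$ and pointing into the upper half-plane; such a ray is encoded as a pair $(x,\theta)$ with $x\in\mathbb{R}$ its origin and $\theta\in(0,\pi)$ its angle with the positive real direction. Topologize $P_0$ as follows: points of $\mathcal{H}$ have their usual Euclidean neighborhoods in $\mathcal{H}$ as basic neighborhoods; a ray $r=(x,\theta)$ has as basic neighborhoods the sets, for $\varepsilon>0$, consisting of all rays $(x,\theta')$ with $\theta'\in(0,\pi)$ and $|\theta'-\theta|<\varepsilon$ (same origin $x$) together with all points $x+\rho e^{i\varphi}\in\mathcal{H}$ with $0<\rho<\varepsilon$, $\varphi\in(0,\pi)$, $|\varphi-\theta|<\varepsilon$. Then $P_0$ is a surface with boundary, whose boundary $\partial P_0$ is the set of all rays. The Prüfer surface $P$ is the double of $P_0$, i.e. $P=P_0\cup_{\mathrm{id}_{\partial P_0}}P_0$: the quotient space of the disjoint union of two copies of $P_0$ obtained by identifying corresponding boundary points. *)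

theory Defs
  imports "HOL-Analysis.Analysis"
begin

section \<open>Topological manifolds\<close>

definition locally_Euclidean_space :: "nat \<Rightarrow> 'a topology \<Rightarrow> bool" where
  "locally_Euclidean_space n X \<longleftrightarrow>
     (\<forall>x\<in>topspace X. \<exists>U V. openin X U \<and> x \<in> U \<and> openin (Euclidean_space n) V \<and>
        subtopology X U homeomorphic_space subtopology (Euclidean_space n) V)"

text \<open>No countability, paracompactness or metrizability condition is imposed.\<close>

definition topological_manifold :: "nat \<Rightarrow> 'a topology \<Rightarrow> bool" where
  "topological_manifold n X \<longleftrightarrow> Hausdorff_space X \<and> locally_Euclidean_space n X"


section \<open>CW-complexes\<close>

text \<open>All three are sets of sequences supported on \<open>{..<n}\<close>.  For \<open>n = 0\<close> both balls are
  the one-point space and the sphere is empty.\<close>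

definition closed_unit_ball :: "nat \<Rightarrow> (nat \<Rightarrow> real) set" where
  "closed_unit_ball n = {u \<in> topspace (Euclidean_space n). (\<Sum>i<n. (u i)\<^sup>2) \<le> 1}"

definition open_unit_ball :: "nat \<Rightarrow> (nat \<Rightarrow> real) set" where
  "open_unit_ball n = {u \<in> topspace (Euclidean_space n). (\<Sum>i<n. (u i)\<^sup>2) < 1}"

definition unit_sphere :: "nat \<Rightarrow> (nat \<Rightarrow> real) set" where
  "unit_sphere n = {u \<in> topspace (Euclidean_space n). (\<Sum>i<n. (u i)\<^sup>2) = 1}"

text \<open>\<open>E\<close> is the set of open cells, \<open>d e\<close> the dimension of the cell \<open>e\<close> and \<open>\<Phi> e\<close> its
  characteristic map.  Since the cells are nonempty and pairwise disjoint, indexing them by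
  themselves is no restriction.\<close>

definition CW_structure ::
  "'a topology \<Rightarrow> 'a set set \<Rightarrow> ('a set \<Rightarrow> nat) \<Rightarrow> ('a set \<Rightarrow> (nat \<Rightarrow> real) \<Rightarrow> 'a) \<Rightarrow> bool"
where
  "CW_structure X E d \<Phi> \<longleftrightarrow>
     disjoint E \<and> \<Union>E = topspace X \<and>
     (\<forall>e\<in>E. continuous_map (subtopology (Euclidean_space (d e)) (closed_unit_ball (d e))) X (\<Phi> e) \<and>
        homeomorphic_map (subtopology (Euclidean_space (d e)) (open_unit_ball (d e)))
          (subtopology X e) (\<Phi> e)) \<and>
     (\<forall>e\<in>E. \<exists>F. finite F \<and> F \<subseteq> {f \<in> E. d f < d e} \<and> \<Phi> e ` unit_sphere (d e) \<subseteq> \<Union>F) \<and>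
     (\<forall>A. A \<subseteq> topspace X \<longrightarrow>
        (closedin X A \<longleftrightarrow> (\<forall>e\<in>E. closedin X (A \<inter> X closure_of e))))"

definition CW_complex :: "'a topology \<Rightarrow> bool" where
  "CW_complex X \<longleftrightarrow> Hausdorff_space X \<and> (\<exists>E d \<Phi>. CW_structure X E d \<Phi>)"


section \<open>Quotients and doubles\<close>

text \<open>Intended for \<open>R\<close> an equivalence relation on the underlying set of \<open>X\<close>.\<close>

definition quotient_topology :: "'a topology \<Rightarrow> ('a \<times> 'a) set \<Rightarrow> 'a set topology" where
  "quotient_topology X R =
     topology (\<lambda>U. U \<subseteq> topspace X // R \<and> openin X {x \<in> topspace X. R `` {x} \<in> U})"

lemma openin_quotient_topology:
  "openin (quotient_topology X R) U \<longleftrightarrow>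
     U \<subseteq> topspace X // R \<and> openin X {x \<in> topspace X. R `` {x} \<in> U}"
proof -
  have 1: "{x \<in> topspace X. R `` {x} \<in> S \<inter> T} =
      {x \<in> topspace X. R `` {x} \<in> S} \<inter> {x \<in> topspace X. R `` {x} \<in> T}" for S T
    by auto
  have 2: "{x \<in> topspace X. R `` {x} \<in> \<Union>\<K>} = (\<Union>K\<in>\<K>. {x \<in> topspace X. R `` {x} \<in> K})" for \<K>
    by auto
  have "istopology (\<lambda>U. U \<subseteq> topspace X // R \<and> openin X {x \<in> topspace X. R `` {x} \<in> U})"
    unfolding istopology_def 1 2 by blast
  then show ?thesis
    by (simp add: quotient_topology_def)
qed

lemma topspace_quotient_topology [simp]: "topspace (quotient_topology X R) = topspace X // R"
proof -
  have "{x \<in> topspace X. R `` {x} \<in> topspace X // R} = topspace X"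
    by (auto simp: quotient_def)
  then have "openin (quotient_topology X R) (topspace X // R)"
    by (simp add: openin_quotient_topology)
  then show ?thesis
    by (metis openin_quotient_topology openin_subset openin_topspace subset_antisym)
qed

lemma quotient_map_quotient_topology:
  "quotient_map X (quotient_topology X R) (\<lambda>x. R `` {x})"
  by (auto simp: quotient_map_def openin_quotient_topology) (auto simp: quotient_def)

definition double_rel :: "'a topology \<Rightarrow> 'a set \<Rightarrow> ((bool \<times> 'a) \<times> (bool \<times> 'a)) set" where
  "double_rel X B = {((i, p), (j, q)). p \<in> topspace X \<and> q = p \<and> (i = j \<or> p \<in> B)}"

lemma equiv_double_rel:
  "equiv (topspace (sum_topology (\<lambda>_. X) UNIV)) (double_rel X B)"
  by (rule equivI) (auto simp: double_rel_def refl_on_def sym_def trans_def)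

text \<open>Two copies of \<open>X\<close>, indexed by the truth values, glued along the identity of \<open>B\<close>.\<close>

definition double_space :: "'a topology \<Rightarrow> 'a set \<Rightarrow> (bool \<times> 'a) set topology" where
  "double_space X B = quotient_topology (sum_topology (\<lambda>_. X) UNIV) (double_rel X B)"


section \<open>The Pruefer surface\<close>

text \<open>\<open>Ray x \<theta>\<close> is the ray with origin \<open>x\<close> and angle \<open>\<theta>\<close>; only the points in the carrier
  sets below are meant.\<close>

datatype pruefer_point = Point complex | Ray real real

definition upper_half_plane :: "complex set" where
  "upper_half_plane = {z. Im z > 0}"

definition pruefer_rays :: "pruefer_point set" where
  "pruefer_rays = {Ray x \<theta> | x \<theta>. \<theta> \<in> {0<..<pi}}"

definition pruefer_carrier :: "pruefer_point set" where
  "pruefer_carrier = Point ` upper_half_plane \<union> pruefer_rays"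

primrec pruefer_nhd :: "pruefer_point \<Rightarrow> real \<Rightarrow> pruefer_point set" where
  "pruefer_nhd (Point z) \<epsilon> = Point ` (ball z \<epsilon> \<inter> upper_half_plane)"
| "pruefer_nhd (Ray x \<theta>) \<epsilon> =
     {Ray x \<theta>' | \<theta>'. \<theta>' \<in> {0<..<pi} \<and> \<bar>\<theta>' - \<theta>\<bar> < \<epsilon>} \<union>
     {Point (of_real x + of_real \<rho> * exp (\<i> * of_real \<phi>)) | \<rho> \<phi>.
        0 < \<rho> \<and> \<rho> < \<epsilon> \<and> \<phi> \<in> {0<..<pi} \<and> \<bar>\<phi> - \<theta>\<bar> < \<epsilon>}"

lemma pruefer_nhd_mono: "\<delta> \<le> \<epsilon> \<Longrightarrow> pruefer_nhd p \<delta> \<subseteq> pruefer_nhd p \<epsilon>"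
  by (cases p) (auto, (force)+)

text \<open>The surface with boundary \<open>P\<^sub>0\<close>.\<close>

definition bordered_pruefer :: "pruefer_point topology" where
  "bordered_pruefer =
     topology (\<lambda>U. U \<subseteq> pruefer_carrier \<and> (\<forall>p\<in>U. \<exists>\<epsilon>>0. pruefer_nhd p \<epsilon> \<subseteq> U))"

lemma openin_bordered_pruefer:
  "openin bordered_pruefer U \<longleftrightarrow>
     U \<subseteq> pruefer_carrier \<and> (\<forall>p\<in>U. \<exists>\<epsilon>>0. pruefer_nhd p \<epsilon> \<subseteq> U)"
proof -
  have "\<exists>\<epsilon>>0. pruefer_nhd p \<epsilon> \<subseteq> S \<inter> T"
    if "\<epsilon>1 > 0" "pruefer_nhd p \<epsilon>1 \<subseteq> S" "\<epsilon>2 > 0" "pruefer_nhd p \<epsilon>2 \<subseteq> T" for p S T \<epsilon>1 \<epsilon>2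
    using that pruefer_nhd_mono[of "min \<epsilon>1 \<epsilon>2" \<epsilon>1 p] pruefer_nhd_mono[of "min \<epsilon>1 \<epsilon>2" \<epsilon>2 p]
    by (intro exI[of _ "min \<epsilon>1 \<epsilon>2"]) auto
  then have "istopology (\<lambda>U. U \<subseteq> pruefer_carrier \<and> (\<forall>p\<in>U. \<exists>\<epsilon>>0. pruefer_nhd p \<epsilon> \<subseteq> U))"
    unfolding istopology_def by (intro conjI allI impI)
      (blast, blast, blast, (meson UnionE Union_upper subset_trans)+)
  then show ?thesis
    by (simp add: bordered_pruefer_def)
qed

lemma pruefer_nhd_subset: "pruefer_nhd p \<epsilon> \<subseteq> pruefer_carrier"
  by (cases p) (auto simp: pruefer_carrier_def pruefer_rays_def upper_half_plane_def
      Im_exp sin_gt_zero)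

lemma topspace_bordered_pruefer [simp]: "topspace bordered_pruefer = pruefer_carrier"
proof -
  have "openin bordered_pruefer pruefer_carrier"
    using pruefer_nhd_subset by (auto simp: openin_bordered_pruefer intro!: exI[of _ 1])
  then show ?thesis
    by (metis openin_bordered_pruefer openin_subset openin_topspace subset_antisym)
qed

definition pruefer_surface :: "(bool \<times> pruefer_point) set topology" where
  "pruefer_surface = double_space bordered_pruefer pruefer_rays"

end

theory Submission
  imports Defs
begin

text \<open>
  The surface is two half-planes joined by uncountably many bridges, one for each real number
  \<open>x\<close>, where the bridge at \<open>x\<close> is the open interval of rays with origin \<open>x\<close>.  It is separable, since a
  countable set is dense in the two half-planes; yet all the bridges matter for its homotopy type.
  These two facts are incompatible for a space with the homotopy type of a CW-complex.

  Let \<open>f\<close> be a map from the surface to a CW-complex \<open>X\<close> with a homotopy inverse \<open>g\<close>.  The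
  image under \<open>f\<close> of a countable dense set lies in a countable subcomplex, which is closed and
  sigma-compact, so the image of \<open>f\<close> lies in that subcomplex
  (\<open>continuous_image_separable_in_CW_complex\<close>).  Hence \<open>g \<circ> f\<close>, which is homotopic to the
  identity, maps the surface into a sigma-compact set.

  This is impossible by \<open>id_not_homotopic_into_sigma_compact\<close>.  The two half-planes and the
  bridge at \<open>x\<close> form an open set, the image of a planar chart, and these sets cover the surface.
  A sigma-compact set is covered by countably many of them, so it misses the bridge at some \<open>x\<close>.
  The map \<open>bridge_phase x\<close> from the surface to the circle has winding number plus or minus one
  on a loop that crosses the bridge at \<open>x\<close> once and returns through another bridge, but it has a
  continuous real-valued argument off the bridge at \<open>x\<close>.  Thus the loop cannot be deformed off that bridge.

  The charts \<open>chart x\<close> are homeomorphisms from the whole plane to open sets and determine the topology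
  (\<open>openin_pruefer_surface_iff_chart\<close>), so they carry the verification of the manifold
  properties as well.  Non-metrizability follows because choosing one ray in every bridge gives
  an uncountable discrete family in a separable space.
\<close>

section \<open>Planar charts of the doubled surface\<close>

definition to_double :: "bool \<times> pruefer_point \<Rightarrow> (bool \<times> pruefer_point) set" where
  "to_double s = double_rel bordered_pruefer pruefer_rays `` {s}"

lemma to_double_eq: 
  "to_double (i, p) = {(j, q). p \<in> pruefer_carrier \<and> q = p \<and> (i = j \<or> p \<in> pruefer_rays)}"
  by (auto simp: to_double_def double_rel_def)

lemma to_double_eq_iff:
  "p \<in> pruefer_carrier \<Longrightarrow>
     to_double (i, p) = to_double (j, q) \<longleftrightarrow> p = q \<and> (i = j \<or> p \<in> pruefer_rays)"
  by (auto simp: to_double_eq set_eq_iff)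

lemma topspace_pruefer_surface:
  "topspace pruefer_surface = to_double ` (UNIV \<times> pruefer_carrier)"
  by (auto simp: pruefer_surface_def double_space_def quotient_def to_double_def)

lemma openin_pruefer_surface:
  "openin pruefer_surface U \<longleftrightarrow> U \<subseteq> topspace pruefer_surface \<and>
     (\<forall>i. openin bordered_pruefer {p \<in> pruefer_carrier. to_double (i, p) \<in> U})"
  unfolding pruefer_surface_def double_space_def openin_quotient_topology to_double_def
  by (simp add: openin_sum_topology subset_iff)

text \<open>The ray at \<open>x\<close> with slope parameter \<open>a\<close> consists of the points \<open>x + (a + \<i>) b\<close> with
  \<open>b > 0\<close>; its angle is the inverse cotangent of \<open>a\<close>, that is, \<open>pi/2 - arctan a\<close>.  In the
  coordinates \<open>(a, b)\<close>, cotangent and height, the half-plane together with the rays at \<open>x\<close>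
  becomes the closed half-plane \<open>b \<ge> 0\<close>.  Unlike polar coordinates, these have no restricted
  first coordinate.\<close>

definition half_chart :: "real \<Rightarrow> real \<Rightarrow> real \<Rightarrow> pruefer_point" where
  "half_chart x a b = (if b = 0 then Ray x (pi/2 - arctan a) else Point (Complex (x + a * b) b))"

lemma half_chart_in_carrier: "b \<ge> 0 \<Longrightarrow> half_chart x a b \<in> pruefer_carrier"
  using arctan_bounded[of a]
  by (auto simp: half_chart_def pruefer_carrier_def pruefer_rays_def upper_half_plane_def)

lemma half_chart_in_rays_iff: "half_chart x a b \<in> pruefer_rays \<longleftrightarrow> b = 0"
  using arctan_bounded[of a]
  by (auto simp: half_chart_def pruefer_rays_def)

lemma arccot_cot: 
  assumes "\<theta> \<in> {0<..<pi}" shows "pi/2 - arctan (cot \<theta>) = \<theta>"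
proof -
  have "arctan (tan (pi/2 - \<theta>)) = pi/2 - \<theta>"
    using assms by (intro arctan_tan) auto
  then show ?thesis by (simp add: tan_cot')
qed

lemma polar_point:
  fixes x \<rho> :: real
  shows "of_real x + of_real \<rho> * exp (\<i> * of_real \<phi>) = Complex (x + \<rho> * cos \<phi>) (\<rho> * sin \<phi>)"
  by (simp add: complex_eq_iff Re_exp Im_exp)

lemma half_chart_eq_polar:
  assumes "b > 0"
  shows "half_chart x a b = Point (of_real x + of_real (b * sqrt (1 + a\<^sup>2)) * exp (\<i> * of_real (pi/2 - arctan a)))"
proof -
  have "1 + a\<^sup>2 > 0" by (simp add: add_pos_nonneg)
  then have [simp]: "1 + a\<^sup>2 \<noteq> 0" by linarith
  show ?thesis
    using assms unfolding polar_point half_chart_def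
    by (simp add: cos_diff sin_diff cos_arctan sin_arctan)
qed

lemma polar_eq_half_chart:
  assumes "\<phi> \<in> {0<..<pi}" "\<rho> > 0"
  shows "Point (of_real x + of_real \<rho> * exp (\<i> * of_real \<phi>)) = half_chart x (cot \<phi>) (\<rho> * sin \<phi>)"
proof -
  have "sin \<phi> > 0" using assms by (auto intro: sin_gt_zero)
  then show ?thesis using assms
    by (simp add: polar_point half_chart_def cot_def)
qed

text \<open>Near a ray the basic neighbourhoods are polar rectangles, and by the polar form of
  \<open>half_chart\<close> the conditions on angle and radius are open conditions on \<open>(a, b)\<close>.  The
  absolute value makes the half-chart a function on the whole plane, so that openness can be
  tested in the plane itself.\<close>

lemma openin_bordered_pruefer_imp_chart:
  assumes "openin bordered_pruefer W"
  shows "open {v. half_chart x (fst v) \<bar>snd v\<bar> \<in> W}"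
proof (subst open_subopen, intro ballI)
  fix v assume v: "v \<in> {v. half_chart x (fst v) \<bar>snd v\<bar> \<in> W}"
  let ?p = "half_chart x (fst v) \<bar>snd v\<bar>"
  obtain \<epsilon> where \<epsilon>: "\<epsilon> > 0" "pruefer_nhd ?p \<epsilon> \<subseteq> W"
    using v assms by (auto simp: openin_bordered_pruefer)
  show "\<exists>T. open T \<and> v \<in> T \<and> T \<subseteq> {v. half_chart x (fst v) \<bar>snd v\<bar> \<in> W}"
  proof (cases "snd v = 0")
    case True
    let ?T = "{w. \<bar>(pi/2 - arctan (fst w)) - (pi/2 - arctan (fst v))\<bar> < \<epsilon> \<and> \<bar>snd w\<bar> * sqrt (1 + (fst w)\<^sup>2) < \<epsilon>}"
    have "open ?T"
      by (intro open_Collect_conj open_Collect_less continuous_intros)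
    moreover have "v \<in> ?T"
      using \<epsilon> True by simp
    moreover have "half_chart x (fst w) \<bar>snd w\<bar> \<in> pruefer_nhd ?p \<epsilon>" if w: "w \<in> ?T" for w
    proof (cases "snd w = 0")
      case True
      then show ?thesis
        using w \<open>snd v = 0\<close> arctan_bounded[of "fst w"] by (auto simp: half_chart_def)
    next
      case False
      let ?\<rho> = "\<bar>snd w\<bar> * sqrt (1 + (fst w)\<^sup>2)" and ?\<phi> = "pi/2 - arctan (fst w)"
      have polar: "half_chart x (fst w) \<bar>snd w\<bar> = Point (of_real x + of_real ?\<rho> * exp (\<i> * of_real ?\<phi>))"
        using False by (intro half_chart_eq_polar) simp
      have ray: "?p = Ray x (pi/2 - arctan (fst v))"
        using \<open>snd v = 0\<close> by (simp add: half_chart_def)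
      have "0 < ?\<rho>"
        using False by (simp add: add_pos_nonneg)
      moreover have "?\<phi> \<in> {0<..<pi}"
        using arctan_bounded[of "fst w"] by auto
      ultimately show ?thesis
        using w unfolding polar ray pruefer_nhd.simps by blast
    qed
    ultimately show ?thesis
      using \<epsilon> by (intro exI[of _ ?T]) blast
  next
    case False
    let ?f = "\<lambda>w. Complex (x + fst w * \<bar>snd w\<bar>) \<bar>snd w\<bar>"
    let ?T = "{w. dist (?f v) (?f w) < \<epsilon> \<and> 0 < \<bar>snd w\<bar>}"
    have "open ?T" unfolding Complex_eq
      by (intro open_Collect_conj open_Collect_less continuous_intros)
    moreover have "v \<in> ?T"
      using \<epsilon> False by simp
    moreover have "half_chart x (fst w) \<bar>snd w\<bar> \<in> pruefer_nhd ?p \<epsilon>" if w: "w \<in> ?T" for w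
      using w False by (auto simp: half_chart_def upper_half_plane_def)
    ultimately show ?thesis
      using \<epsilon> by (intro exI[of _ ?T]) blast
  qed
qed

text \<open>The converse uses that the inverse of a half-chart, \<open>z \<mapsto> ((Re z - x) / Im z, Im z)\<close> in
  Cartesian and \<open>(\<phi>, \<rho>) \<mapsto> (cot \<phi>, \<rho> sin \<phi>)\<close> in polar form, is continuous.  A point of the
  half-plane lies in every half-chart, so the one at \<open>0\<close> serves for all of them.\<close>

lemma chart_imp_openin_bordered_pruefer:
  assumes W: "W \<subseteq> pruefer_carrier" and op: "\<And>x. open {v. half_chart x (fst v) \<bar>snd v\<bar> \<in> W}"
  shows "openin bordered_pruefer W"
  unfolding openin_bordered_pruefer
proof (intro conjI W ballI)
  fix p assume p: "p \<in> W"
  show "\<exists>\<epsilon>>0. pruefer_nhd p \<epsilon> \<subseteq> W"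
  proof (cases p)
    case (Point z)
    then have z: "Im z > 0"
      using p W by (auto simp: pruefer_carrier_def upper_half_plane_def pruefer_rays_def)
    let ?A = "{v. half_chart 0 (fst v) \<bar>snd v\<bar> \<in> W}"
    let ?f = "\<lambda>z. (Re z / Im z, Im z)"
    have eq: "half_chart 0 (fst (?f w)) \<bar>snd (?f w)\<bar> = Point w" if "Im w > 0" for w
      using that by (simp add: half_chart_def)
    have "open {w. 0 < Im w}"
      by (intro open_Collect_less continuous_intros)
    moreover have "continuous_on {w. 0 < Im w} ?f"
      by (intro continuous_intros) auto
    ultimately have "open (?f -` ?A \<inter> {w. 0 < Im w})"
      using op[of 0] continuous_on_open_vimage by blast
    moreover have "z \<in> ?f -` ?A \<inter> {w. 0 < Im w}"
      using z p eq[OF z] Point by simp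
    ultimately obtain \<epsilon> where \<epsilon>: "\<epsilon> > 0" "ball z \<epsilon> \<subseteq> ?f -` ?A \<inter> {w. 0 < Im w}"
      using open_contains_ball by blast
    have "pruefer_nhd p \<epsilon> \<subseteq> W"
    proof
      fix q assume "q \<in> pruefer_nhd p \<epsilon>"
      then obtain w where w: "q = Point w" "w \<in> ball z \<epsilon>"
        using Point by auto
      with \<epsilon> have "w \<in> ?f -` ?A" "Im w > 0" by auto
      then show "q \<in> W" using eq[of w] w by auto
    qed
    then show ?thesis using \<epsilon> by auto
  next
    case (Ray x \<theta>)
    then have \<theta>: "\<theta> \<in> {0<..<pi}"
      using p W by (auto simp: pruefer_carrier_def upper_half_plane_def pruefer_rays_def)
    let ?A = "{v. half_chart x (fst v) \<bar>snd v\<bar> \<in> W}"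
    let ?S = "{0<..<pi} \<times> (UNIV :: real set)"
    let ?f = "\<lambda>(\<phi>, \<rho>). (cot \<phi>, \<rho> * sin \<phi>)"
    have ray: "half_chart x (cot \<phi>) 0 = Ray x \<phi>" if "\<phi> \<in> {0<..<pi}" for \<phi>
      using arccot_cot[OF that] by (simp add: half_chart_def)
    have "sin \<phi> \<noteq> 0" if "\<phi> \<in> {0<..<pi}" for \<phi> :: real
      using sin_gt_zero[of \<phi>] that by auto
    then have "continuous_on ?S ?f"
      unfolding case_prod_unfold cot_def by (intro continuous_intros) auto
    moreover have "open ?S" by (intro open_Times) auto
    ultimately have "open (?f -` ?A \<inter> ?S)"
      using op[of x] continuous_on_open_vimage by blast
    moreover have "(\<theta>, 0) \<in> ?f -` ?A \<inter> ?S"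
      using \<theta> p Ray ray[OF \<theta>] by simp
    ultimately obtain T1 T2 where T: "open T1" "open T2" "(\<theta>, 0) \<in> T1 \<times> T2" "T1 \<times> T2 \<subseteq> ?f -` ?A \<inter> ?S"
      by (rule open_prod_elim)
    then obtain \<epsilon>1 \<epsilon>2 where \<epsilon>: "\<epsilon>1 > 0" "\<epsilon>2 > 0" "ball \<theta> \<epsilon>1 \<subseteq> T1" "ball 0 \<epsilon>2 \<subseteq> T2"
      using open_contains_ball by (metis mem_Sigma_iff)
    let ?\<epsilon> = "min \<epsilon>1 \<epsilon>2"
    have main: "half_chart x (cot \<phi>) \<bar>\<rho> * sin \<phi>\<bar> \<in> W" if "\<bar>\<phi> - \<theta>\<bar> < ?\<epsilon>" "\<bar>\<rho>\<bar> < ?\<epsilon>" for \<phi> \<rho>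
    proof -
      have "\<phi> \<in> ball \<theta> \<epsilon>1" "\<rho> \<in> ball 0 \<epsilon>2"
        using that by (auto simp: dist_real_def)
      then have "(\<phi>, \<rho>) \<in> T1 \<times> T2"
        using \<epsilon> by auto
      then show ?thesis using T(4) by auto
    qed
    have "pruefer_nhd p ?\<epsilon> \<subseteq> W"
    proof
      fix q assume "q \<in> pruefer_nhd p ?\<epsilon>"
      then consider \<phi> where "q = Ray x \<phi>" "\<phi> \<in> {0<..<pi}" "\<bar>\<phi> - \<theta>\<bar> < ?\<epsilon>"
        | \<rho> \<phi> where "q = Point (of_real x + of_real \<rho> * exp (\<i> * of_real \<phi>))" 
           "0 < \<rho>" "\<rho> < ?\<epsilon>" "\<phi> \<in> {0<..<pi}" "\<bar>\<phi> - \<theta>\<bar> < ?\<epsilon>"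
        unfolding Ray pruefer_nhd.simps by blast
      then show "q \<in> W"
      proof cases
        case 1
        then show ?thesis
          using main[of \<phi> 0] \<epsilon> ray by simp
      next
        case 2
        have "sin \<phi> > 0" using 2 by (auto intro: sin_gt_zero)
        then show ?thesis
          using 2 main[of \<phi> \<rho>] polar_eq_half_chart[of \<phi> \<rho> x] by simp
      qed
    qed
    then show ?thesis using \<epsilon> by (intro exI[of _ ?\<epsilon>]) auto
  qed
qed

text \<open>The sign of \<open>b\<close> chooses the copy of the bordered surface.  On the axis \<open>b = 0\<close>
  the points are rays, where the two copies are glued, so either copy gives the same point.\<close>

definition chart :: "real \<Rightarrow> real \<times> real \<Rightarrow> (bool \<times> pruefer_point) set" where
  "chart x v = to_double (snd v > 0, half_chart x (fst v) \<bar>snd v\<bar>)"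

lemma chart_in_topspace [simp]: "chart x v \<in> topspace pruefer_surface"
  by (auto simp: chart_def topspace_pruefer_surface half_chart_in_carrier)

lemma to_double_half_chart: 
  "to_double (i, half_chart x a \<bar>b\<bar>) = chart x (a, if i then \<bar>b\<bar> else - \<bar>b\<bar>)"
  by (auto simp: chart_def to_double_eq_iff half_chart_in_carrier half_chart_in_rays_iff)

text \<open>The topology of the double is the final topology of the family of charts.  On either
  side of the axis a chart sees one copy only; near the axis a set is open precisely when its traces
  on both copies are.\<close>

lemma openin_pruefer_surface_iff_chart:
  "openin pruefer_surface U \<longleftrightarrow> U \<subseteq> topspace pruefer_surface \<and> (\<forall>x. open (chart x -` U))"
proof (intro iffI conjI allI)
  fix x
  assume U: "openin pruefer_surface U"
  let ?A = "\<lambda>i. {v. half_chart x (fst v) \<bar>snd v\<bar> \<in> {p \<in> pruefer_carrier. to_double (i, p) \<in> U}}"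
  have A: "open (?A i)" for i
    using U openin_bordered_pruefer_imp_chart unfolding openin_pruefer_surface by blast
  have "chart x -` U = ({v. snd v > 0} \<inter> ?A True) \<union> ({v. snd v < 0} \<inter> ?A False) \<union> (?A True \<inter> ?A False)"
  proof (intro set_eqI)
    fix v :: "real \<times> real"
    obtain a b where v: "v = (a, b)" by (cases v)
    consider "b > 0" | "b = 0" | "b < 0" by linarith
    then show "v \<in> chart x -` U \<longleftrightarrow>
       v \<in> ({v. snd v > 0} \<inter> ?A True) \<union> ({v. snd v < 0} \<inter> ?A False) \<union> (?A True \<inter> ?A False)"
      by cases (auto simp: v to_double_half_chart half_chart_in_carrier)
  qed
  moreover have "open {v::real\<times>real. snd v > 0}" "open {v::real\<times>real. snd v < 0}"
    by (intro open_Collect_less continuous_intros)+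
  ultimately show "open (chart x -` U)"
    using A[of True] A[of False] by (simp only: open_Int open_Un)
next
  assume U: "U \<subseteq> topspace pruefer_surface \<and> (\<forall>x. open (chart x -` U))"
  have "open {v. half_chart x (fst v) \<bar>snd v\<bar> \<in> {p \<in> pruefer_carrier. to_double (i, p) \<in> U}}" for x i
  proof -
    let ?f = "\<lambda>v::real\<times>real. (fst v, (if i then 1 else -1) * \<bar>snd v\<bar>)"
    have "open (?f -` (chart x -` U))"
      using U by (intro open_vimage continuous_intros) auto
    moreover have "?f -` (chart x -` U) = {v. half_chart x (fst v) \<bar>snd v\<bar> \<in> {p \<in> pruefer_carrier. to_double (i, p) \<in> U}}"
      by (auto simp: to_double_half_chart half_chart_in_carrier split: if_splits)
    ultimately show ?thesis by simp
  qed
  then show "openin pruefer_surface U"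
    using U by (auto simp: openin_pruefer_surface intro!: chart_imp_openin_bordered_pruefer)
qed (auto simp: openin_pruefer_surface)

lemma continuous_map_chart: "continuous_map euclidean pruefer_surface (chart x)"
  by (auto simp: continuous_map_def openin_pruefer_surface_iff_chart vimage_def)

lemma chart_eq_iff:
  "chart x v = chart y w \<longleftrightarrow> snd v = snd w \<and> 
     (if snd v = 0 then x = y \<and> fst v = fst w else x + fst v * \<bar>snd v\<bar> = y + fst w * \<bar>snd w\<bar>)"
  unfolding chart_def
  by (simp add: to_double_eq_iff half_chart_in_carrier half_chart_in_rays_iff)
     (auto simp: half_chart_def arctan_eq_iff)

lemma inj_chart: "inj (chart x)"
  by (rule injI) (auto simp: chart_eq_iff prod_eq_iff split: if_splits)

lemma chart_surj: 
  assumes "c \<in> topspace pruefer_surface"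
  obtains x v where "c = chart x v"
proof -
  obtain i p where c: "c = to_double (i, p)" "p \<in> pruefer_carrier"
    using assms by (auto simp: topspace_pruefer_surface)
  have "\<exists>x a b. b \<ge> 0 \<and> p = half_chart x a b"
  proof (cases p)
    case (Point z)
    then have "Im z > 0" 
      using c by (auto simp: pruefer_carrier_def upper_half_plane_def pruefer_rays_def)
    then show ?thesis using Point
      by (intro exI[of _ 0] exI[of _ "Re z / Im z"] exI[of _ "Im z"]) (simp add: half_chart_def)
  next
    case (Ray x \<theta>)
    then have "\<theta> \<in> {0<..<pi}" 
      using c by (auto simp: pruefer_carrier_def upper_half_plane_def pruefer_rays_def)
    then show ?thesis using Ray arccot_cot[of \<theta>]
      by (intro exI[of _ x] exI[of _ "cot \<theta>"] exI[of _ 0]) (simp add: half_chart_def)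
  qed
  then show ?thesis
    using that c to_double_half_chart by (metis abs_of_nonneg)
qed

text \<open>Both charts cover the half-planes of both copies, and there they differ by a shear,
  which has no continuous extension to the axis.\<close>

lemma chart_change:
  "snd v \<noteq> 0 \<Longrightarrow> chart y v = chart x (fst v + (y - x) / \<bar>snd v\<bar>, snd v)"
  by (simp add: chart_eq_iff field_simps)

lemma open_map_chart: "open_map euclidean pruefer_surface (chart x)"
  unfolding open_map_def
proof (intro allI impI)
  fix A :: "(real \<times> real) set" assume "openin euclidean A"
  then have A: "open A" by simp
  have "open (chart y -` chart x ` A)" for y
  proof (cases "y = x")
    case True
    then show ?thesis using A inj_chart by (simp add: inj_vimage_image_eq)
  next
    case False
    let ?f = "\<lambda>v. (fst v + (y - x) / \<bar>snd v\<bar>, snd v)"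
    \<comment> \<open>The images of two different charts meet exactly off the axis.\<close>
    have "open {v::real\<times>real. snd v \<noteq> 0}"
      by (intro open_Collect_neq continuous_intros)
    moreover have "continuous_on {v::real\<times>real. snd v \<noteq> 0} ?f"
      by (intro continuous_intros) auto
    ultimately have "open (?f -` A \<inter> {v. snd v \<noteq> 0})"
      using A continuous_on_open_vimage by blast
    moreover have "chart y -` chart x ` A = ?f -` A \<inter> {v. snd v \<noteq> 0}"
    proof -
      have "chart y v \<in> chart x ` A \<longleftrightarrow> ?f v \<in> A \<and> snd v \<noteq> 0" for v
      proof (cases "snd v = 0")
        case True
        then show ?thesis using False by (auto simp: chart_eq_iff)
      next
        case 2: False
        then show ?thesis
          unfolding chart_change[OF 2, of y x] using inj_chart by (simp add: inj_image_mem_iff)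
      qed
      then show ?thesis by auto
    qed
    ultimately show ?thesis by simp
  qed
  then show "openin pruefer_surface (chart x ` A)"
    by (auto simp: openin_pruefer_surface_iff_chart)
qed

lemma openin_chart_image: "open A \<Longrightarrow> openin pruefer_surface (chart x ` A)"
  using open_map_chart[of x] by (simp add: open_map_def)

text \<open>Continuity is stated on the part of the surface covered by a set \<open>Y\<close> of charts, because the
  function \<open>signed_height x\<close> below is continuous only away from the rays at \<open>x\<close>.\<close>

lemma continuous_map_from_charts:
  fixes f :: "(bool \<times> pruefer_point) set \<Rightarrow> 'a::topological_space"
  assumes "\<And>x. x \<in> Y \<Longrightarrow> continuous_on UNIV (\<lambda>v. f (chart x v))"
  shows "continuous_map (subtopology pruefer_surface (\<Union>x\<in>Y. range (chart x))) euclidean f"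
  unfolding continuous_map_def
proof (intro conjI allI impI)
  fix V :: "'a set" assume "openin euclidean V"
  then have V: "open V" by simp
  let ?D = "\<Union>x\<in>Y. range (chart x)"
  have "{c \<in> ?D. f c \<in> V} = (\<Union>x\<in>Y. chart x ` ((\<lambda>v. f (chart x v)) -` V))"
    by auto
  also have "openin pruefer_surface \<dots>"
    using V assms by (intro openin_Union ballI) (auto intro!: openin_chart_image open_vimage)
  finally have "openin pruefer_surface {c \<in> ?D. f c \<in> V}" .
  then have "openin (subtopology pruefer_surface ?D) {c \<in> ?D. f c \<in> V}"
    by (simp add: openin_subtopology_alt) blast
  moreover have "{c \<in> topspace (subtopology pruefer_surface ?D). f c \<in> V} = {c \<in> ?D. f c \<in> V}"
    by auto
  ultimately show "openin (subtopology pruefer_surface ?D) {c \<in> topspace (subtopology pruefer_surface ?D). f c \<in> V}"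
    by simp
qed auto

section \<open>Local structure, separability and non-metrizability\<close>

lemma homeomorphic_plane_Euclidean_space:
  "(euclidean :: (real \<times> real) topology) homeomorphic_space Euclidean_space 2"
proof -
  let ?f = "\<lambda>v::real\<times>real. \<lambda>i. if i < 2 then (if i = 0 then fst v else snd v) else (0::real)"
  let ?g = "\<lambda>w::nat\<Rightarrow>real. (w 0, w 1)"
  have "continuous_map euclidean (Euclidean_space 2) ?f"
    unfolding continuous_map_componentwise_Euclidean_space
    by (auto intro!: continuous_intros)
  moreover have "continuous_map (Euclidean_space 2) euclidean ?g"
    unfolding continuous_map_Euclidean_space_iff
    by (intro continuous_intros continuous_on_subset[OF continuous_on_product_coordinates]) auto
  moreover have "?f (?g w) = w" if "w \<in> topspace (Euclidean_space 2)" for w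
  proof
    fix i
    show "?f (?g w) i = w i"
      using that less_2_cases[of i] by (auto simp: topspace_Euclidean_space)
  qed
  moreover have "?g (?f v) = v" for v
    by simp
  ultimately have "homeomorphic_maps euclidean (Euclidean_space 2) ?f ?g"
    unfolding homeomorphic_maps_def by blast
  then show ?thesis
    using homeomorphic_maps_imp_homeomorphic_space by blast
qed

lemma locally_Euclidean_pruefer_surface: "locally_Euclidean_space 2 pruefer_surface"
  unfolding locally_Euclidean_space_def
proof
  fix c assume "c \<in> topspace pruefer_surface"
  then obtain x v where c: "c = chart x v"
    by (rule chart_surj)
  let ?U = "range (chart x)"
  have "embedding_map euclidean pruefer_surface (chart x)"
    using continuous_map_chart open_map_chart inj_chart by (auto intro: injective_open_imp_embedding_map)
  then have "(euclidean :: (real \<times> real) topology) homeomorphic_space subtopology pruefer_surface ?U"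
    using embedding_map_imp_homeomorphic_space by fastforce
  then have "subtopology pruefer_surface ?U homeomorphic_space Euclidean_space 2"
    using homeomorphic_plane_Euclidean_space homeomorphic_space_sym homeomorphic_space_trans by blast
  then show "\<exists>U V. openin pruefer_surface U \<and> c \<in> U \<and> openin (Euclidean_space 2) V \<and>
        subtopology pruefer_surface U homeomorphic_space subtopology (Euclidean_space 2) V"
    using c openin_chart_image[of UNIV x]
    by (intro exI[of _ ?U] exI[of _ "topspace (Euclidean_space 2)"]) auto
qed

text \<open>The chart at \<open>0\<close> already has dense image: every nonempty open set contains points off the
  rays, and these lie in every chart.\<close>

lemma separable_pruefer_surface: "separable_space pruefer_surface"
proof -
  obtain D :: "(real \<times> real) set" where D: "countable D" "\<And>S. open S \<Longrightarrow> S \<noteq> {} \<Longrightarrow> \<exists>d\<in>D. d \<in> S"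
    using countable_dense_setE by metis
  have "\<exists>d\<in>D. chart 0 d \<in> U" if U: "openin pruefer_surface U" "c \<in> U" for U c
  proof -
    obtain x v where c: "c = chart x v"
      using U openin_subset by (metis chart_surj subsetD)
    have "open (chart x -` U)"
      using U by (simp add: openin_pruefer_surface_iff_chart)
    then obtain T1 T2 where T: "open T1" "open T2" "(fst v, snd v) \<in> T1 \<times> T2" "T1 \<times> T2 \<subseteq> chart x -` U"
      using U c by (metis open_prod_elim prod.collapse vimageI)
    then obtain \<epsilon> where \<epsilon>: "\<epsilon> > 0" "ball (snd v) \<epsilon> \<subseteq> T2"
      by (metis mem_Sigma_iff open_contains_ball)
    \<comment> \<open>Move off the axis, staying inside the open set.\<close>
    define b where "b = (if snd v = 0 then \<epsilon> / 2 else snd v)"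
    have b: "b \<noteq> 0" "b \<in> T2"
      using \<epsilon> T by (auto simp: b_def dist_real_def subset_iff)
    then have "chart x (fst v, b) \<in> U"
      using T by auto
    then have "chart 0 -` U \<noteq> {}"
      using b chart_change[of "(fst v, b)" x 0] by auto
    moreover have "open (chart 0 -` U)"
      using U by (simp add: openin_pruefer_surface_iff_chart)
    ultimately show ?thesis
      using D by blast
  qed
  then have "pruefer_surface closure_of (chart 0 ` D) = topspace pruefer_surface"
    by (auto simp: in_closure_of) 
  then show ?thesis
    unfolding separable_space_def using D
    by (intro exI[of _ "chart 0 ` D"]) auto
qed

text \<open>Balls around the points \<open>p i\<close> of half the radius that separates \<open>p i\<close> from the others are
  disjoint, so distinct indices pick distinct points of a countable dense set.\<close>

lemma countable_discrete_family_separable_metrizable: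
  assumes "metrizable_space X" "separable_space X"
    and U: "\<And>i. i \<in> I \<Longrightarrow> openin X (U i) \<and> p i \<in> U i"
    and disc: "\<And>i j. i \<in> I \<Longrightarrow> j \<in> I \<Longrightarrow> p j \<in> U i \<Longrightarrow> j = i"
  shows "countable I"
proof -
  obtain M d where M: "Metric_space M d" "X = Metric_space.mtopology M d"
    using assms by (auto simp: metrizable_space_def)
  interpret Metric_space M d by (rule M)
  obtain D where D: "countable D" "X closure_of D = topspace X"
    using assms by (auto simp: separable_space_def)
  have "\<exists>r>0. mball (p i) r \<subseteq> U i" if "i \<in> I" for i
    using U[OF that] M by (auto simp: openin_mtopology)
  then obtain r where r: "\<And>i. i \<in> I \<Longrightarrow> r i > 0" "\<And>i. i \<in> I \<Longrightarrow> mball (p i) (r i) \<subseteq> U i"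
    by metis
  have p: "p i \<in> M" if "i \<in> I" for i
    using U[OF that] openin_subset M by fastforce
  have "\<exists>c\<in>D. c \<in> mball (p i) (r i / 2)" if "i \<in> I" for i
  proof -
    have "p i \<in> X closure_of D"
      using D p that M by simp
    moreover have "openin X (mball (p i) (r i / 2))" "p i \<in> mball (p i) (r i / 2)"
      using M r p that by auto
    ultimately show ?thesis
      by (metis in_closure_of)
  qed
  then obtain c where c: "\<And>i. i \<in> I \<Longrightarrow> c i \<in> D" "\<And>i. i \<in> I \<Longrightarrow> c i \<in> mball (p i) (r i / 2)"
    by metis
  \<comment> \<open>A common point of two half-radius balls puts one centre in the full ball of the other.\<close>
  have near: "i = j" if "i \<in> I" "j \<in> I" "c i = c j" "r j \<le> r i" for i j
  proof -
    have "d (p i) (c i) < r i / 2" "d (p j) (c i) < r j / 2" "c i \<in> M"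
      using c that by force+
    moreover have "d (p i) (p j) \<le> d (p i) (c i) + d (p j) (c i)"
      using p that \<open>c i \<in> M\<close> triangle'' commute by metis
    ultimately have "p j \<in> mball (p i) (r i)"
      using p that by auto
    then show ?thesis
      using r disc that by blast
  qed
  have "inj_on c I"
    using near by (intro inj_onI) (metis linear)
  then show ?thesis
    using D c by (metis countable_image_inj_on countable_subset image_subsetI)
qed

definition bridge_point :: "real \<Rightarrow> (bool \<times> pruefer_point) set" where
  "bridge_point x = chart x (0, 0)"

lemma bridge_point_in_chart_iff: "bridge_point x \<in> range (chart y) \<longleftrightarrow> x = y"
  by (auto simp: bridge_point_def chart_eq_iff)

text \<open>The points \<open>bridge_point x\<close> form an uncountable discrete family: the open set
  \<open>range (chart x)\<close> contains only one of them.\<close>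

lemma not_metrizable_pruefer_surface: "\<not> metrizable_space pruefer_surface"
proof
  assume "metrizable_space pruefer_surface"
  then have "countable (UNIV :: real set)"
    using separable_pruefer_surface
    by (rule countable_discrete_family_separable_metrizable[where U = "\<lambda>x. range (chart x)" and p = bridge_point])
       (auto intro: openin_chart_image simp: bridge_point_in_chart_iff)
  then show False
    using uncountable_UNIV_real by blast
qed

section \<open>A circle-valued map that detects crossing a bridge\<close>

text \<open>The Moebius map \<open>z \<mapsto> -1 / (z - x)\<close> preserves the upper half-plane and sends \<open>x\<close> to infinity;
  the value here is the imaginary part of the image, with a sign that tells the copy.  Its level
  sets are horocycles at \<open>x\<close>.  It tends to \<open>0\<close> at the rays with origin \<open>y \<noteq> x\<close>, whereas at
  the rays with origin \<open>x\<close> it tends to plus or minus infinity, depending on the side.  The value \<open>0\<close>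
  at the rays with origin \<open>x\<close> is a default.\<close>

definition signed_height :: "real \<Rightarrow> (bool \<times> pruefer_point) set \<Rightarrow> real" where
  "signed_height x c = the_elem ((\<lambda>(i, p). case p of 
       Point z \<Rightarrow> (if i then 1 else -1) * Im z / (cmod (z - of_real x))\<^sup>2 
     | Ray y \<theta> \<Rightarrow> 0) ` c)"

lemma signed_height_chart:
  assumes "y \<noteq> x \<or> snd v \<noteq> 0"
  shows "signed_height x (chart y v) = snd v / ((y - x + fst v * \<bar>snd v\<bar>)\<^sup>2 + (snd v)\<^sup>2)"
proof (cases "snd v = 0")
  case True
  then have "chart y v = UNIV \<times> {half_chart y (fst v) 0}"
    unfolding chart_def to_double_eq using half_chart_in_carrier[of 0 y "fst v"] half_chart_in_rays_iff[of y "fst v" 0]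
    by auto
  then have "(\<lambda>(i, p). case p of 
       Point z \<Rightarrow> (if i then 1 else -1) * Im z / (cmod (z - of_real x))\<^sup>2 
     | Ray y \<theta> \<Rightarrow> 0) ` chart y v = {0}"
    by (force simp: half_chart_def)
  then show ?thesis
    using True by (simp add: signed_height_def)
next
  case False
  then have "chart y v = {(snd v > 0, half_chart y (fst v) \<bar>snd v\<bar>)}"
    unfolding chart_def to_double_eq using half_chart_in_carrier[of "\<bar>snd v\<bar>" y "fst v"] half_chart_in_rays_iff[of y "fst v" "\<bar>snd v\<bar>"]
    by auto
  then show ?thesis
    using False by (auto simp: signed_height_def half_chart_def cmod_power2 add_diff_eq algebra_simps)
qed

text \<open>The signed height takes values in the real line and, on the bridge of rays at \<open>x\<close>, the value
  infinity.  Composing with \<open>u \<mapsto> cis (2 * arctan u)\<close>, which extends to a homeomorphism from the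
  projective line to the circle with infinity going to \<open>-1\<close>, gives a continuous map to the
  circle.  Along a loop, its winding number counts the crossings of the bridge at \<open>x\<close>
  with their directions.\<close>

definition bridge_phase :: "real \<Rightarrow> (bool \<times> pruefer_point) set \<Rightarrow> complex" where
  "bridge_phase x c = (if c \<in> chart x ` {v. snd v = 0} then - 1 else cis (2 * arctan (signed_height x c)))"

lemma bridge_phase_other_chart:
  assumes "y \<noteq> x"
  shows "bridge_phase x (chart y v) = cis (2 * arctan (snd v / ((y - x + fst v * \<bar>snd v\<bar>)\<^sup>2 + (snd v)\<^sup>2)))"
  using assms by (auto simp: bridge_phase_def signed_height_chart chart_eq_iff)

text \<open>In the chart at \<open>x\<close> the signed height is the reciprocal of \<open>S = (a\<^sup>2 + 1) b\<close>, and
  \<open>arctan (1 / S) = sgn S * pi/2 - arctan S\<close>.  The jump of the sign becomes a full turn, so the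
  formula extends continuously over the axis.\<close>

lemma bridge_phase_own_chart:
  "bridge_phase x (chart x v) = - cis (- 2 * arctan (((fst v)\<^sup>2 + 1) * snd v))"
proof (cases "snd v = 0")
  case True
  then show ?thesis by (auto simp: bridge_phase_def)
next
  case False
  let ?S = "((fst v)\<^sup>2 + 1) * snd v"
  have "(fst v)\<^sup>2 + 1 > 0" by (simp add: add_nonneg_pos)
  then have S: "?S \<noteq> 0" "sgn ?S = 1 \<or> sgn ?S = -1" 
    using False by (auto simp: sgn_real_def simp del: mult_eq_0_iff)
  have "signed_height x (chart x v) = snd v / ((fst v * \<bar>snd v\<bar>)\<^sup>2 + (snd v)\<^sup>2)"
    using False signed_height_chart[of x x v] by simp
  also have "(fst v * \<bar>snd v\<bar>)\<^sup>2 + (snd v)\<^sup>2 = ?S * snd v"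
    by (simp add: power_mult_distrib algebra_simps power2_eq_square)
  finally have "signed_height x (chart x v) = 1 / ?S"
    using False by simp
  moreover have "chart x v \<notin> chart x ` {v. snd v = 0}"
    using False inj_chart by (auto simp: inj_image_mem_iff)
  ultimately have "bridge_phase x (chart x v) = cis (2 * arctan (1 / ?S))"
    by (simp add: bridge_phase_def)
  also have "\<dots> = cis (sgn ?S * pi) * cis (- 2 * arctan ?S)"
    unfolding Transcendental.arctan_inverse[OF S(1)] by (simp add: cis_mult algebra_simps del: mult_eq_0_iff)
  also have "cis (sgn ?S * pi) = - 1"
    using S(2) by (auto simp: complex_eq_iff)
  finally show ?thesis by simp
qed

text \<open>Away from the bridge at \<open>x\<close>, \<open>bridge_phase x\<close> therefore has a continuous real-valued
  argument, namely \<open>2 * arctan (signed_height x c)\<close>.\<close>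

lemma continuous_signed_height:
  assumes "x \<notin> Y"
  shows "continuous_map (subtopology pruefer_surface (\<Union>y\<in>Y. range (chart y))) euclidean (signed_height x)"
proof (rule continuous_map_from_charts)
  fix y assume "y \<in> Y"
  then have xy: "y \<noteq> x" using assms by auto
  have "(y - x + fst v * \<bar>snd v\<bar>)\<^sup>2 + (snd v)\<^sup>2 \<noteq> 0" for v :: "real \<times> real"
    using xy by (auto simp: sum_power2_eq_zero_iff)
  then show "continuous_on UNIV (\<lambda>v. signed_height x (chart y v))"
    using xy by (simp add: signed_height_chart) (intro continuous_intros, auto)
qed

lemma Union_charts: "(\<Union>x. range (chart x)) = topspace pruefer_surface"
  using chart_surj by (auto, metis rangeI)

lemma continuous_bridge_phase: "continuous_map pruefer_surface euclidean (bridge_phase x)"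
proof -
  have "continuous_on UNIV (\<lambda>v. bridge_phase x (chart y v))" for y
  proof (cases "y = x")
    case True
    then show ?thesis unfolding True bridge_phase_own_chart by (intro continuous_intros)
  next
    case False
    then have "(y - x + fst v * \<bar>snd v\<bar>)\<^sup>2 + (snd v)\<^sup>2 \<noteq> 0" for v :: "real \<times> real"
      by (auto simp: sum_power2_eq_zero_iff)
    then show ?thesis
      unfolding bridge_phase_other_chart[OF False] by (intro continuous_intros) auto
  qed
  then have "continuous_map (subtopology pruefer_surface (\<Union>y\<in>UNIV. range (chart y))) euclidean (bridge_phase x)"
    by (intro continuous_map_from_charts)
  then show ?thesis
    by (simp add: Union_charts)
qed

lemma bridge_phase_eq_cis:
  "x \<notin> Y \<Longrightarrow> c \<in> (\<Union>y\<in>Y. range (chart y)) \<Longrightarrow> bridge_phase x c = cis (2 * arctan (signed_height x c))"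
  by (auto simp: bridge_phase_def chart_eq_iff)

text \<open>Two points in a common chart are separated inside it.  The only other pairs are rays with
  different origins \<open>x\<close> and \<open>y\<close>, and these are separated by \<open>bridge_phase x\<close>, with values
  \<open>-1\<close> and \<open>1\<close>.\<close>

lemma Hausdorff_pruefer_surface: "Hausdorff_space pruefer_surface"
  unfolding Hausdorff_space_def
proof (intro allI impI)
  fix c c' assume *: "c \<in> topspace pruefer_surface \<and> c' \<in> topspace pruefer_surface \<and> c \<noteq> c'"
  then obtain x v y w where c: "c = chart x v" "c' = chart y w"
    by (metis chart_surj)
  have same: "\<exists>U V. openin pruefer_surface U \<and> openin pruefer_surface V \<and> chart z a \<in> U \<and> chart z b \<in> V \<and> disjnt U V"
    if "chart z a \<noteq> chart z b" for z a b
  proof -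
    obtain A B where "open A" "open B" "a \<in> A" "b \<in> B" "A \<inter> B = {}"
      using \<open>chart z a \<noteq> chart z b\<close> by (metis hausdorff)
    moreover from this have "chart z ` A \<inter> chart z ` B = {}"
      by (metis image_Int image_empty inj_chart)
    ultimately show ?thesis
      by (intro exI[of _ "chart z ` A"] exI[of _ "chart z ` B"])
         (simp add: openin_chart_image disjnt_def)
  qed
  consider "x = y" | "snd v \<noteq> 0" | "snd w \<noteq> 0" | "x \<noteq> y" "snd v = 0" "snd w = 0"
    by blast
  then show "\<exists>U V. openin pruefer_surface U \<and> openin pruefer_surface V \<and> c \<in> U \<and> c' \<in> V \<and> disjnt U V"
  proof cases
    case 1
    then show ?thesis using same * c by blast
  next
    case 2
    then show ?thesis using same * c chart_change[of v x y] by metis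
  next
    case 3
    then show ?thesis using same * c chart_change[of w y x] by metis
  next
    case 4
    then have "bridge_phase x c = - 1" "bridge_phase x c' = 1"
      using c by (simp_all add: bridge_phase_own_chart bridge_phase_other_chart)
    then obtain A B where AB: "open A" "open B" "bridge_phase x c \<in> A" "bridge_phase x c' \<in> B" "A \<inter> B = {}"
      by (metis hausdorff one_neq_neg_one)
    let ?pre = "\<lambda>A. {c \<in> topspace pruefer_surface. bridge_phase x c \<in> A}"
    have "openin pruefer_surface (?pre A)" "openin pruefer_surface (?pre B)"
      using AB by (auto intro!: openin_continuous_map_preimage[OF continuous_bridge_phase])
    then show ?thesis
      using AB * by (intro exI[of _ "?pre A"] exI[of _ "?pre B"]) (auto simp: disjnt_def)
  qed
qed

section \<open>Countable subsets of CW-complexes\<close>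

lemma closedin_closed_unit_ball: "closedin (Euclidean_space n) (closed_unit_ball n)"
proof -
  have "closed {u :: nat \<Rightarrow> real. (\<Sum>i<n. (u i)\<^sup>2) \<le> 1}"
    by (intro closed_Collect_le continuous_intros continuous_on_product_coordinates)
  moreover have "closed (topspace (Euclidean_space n))"
    using closedin_Euclidean_space_iff by blast
  ultimately show ?thesis
    by (auto simp: closedin_Euclidean_space_iff closed_unit_ball_def Collect_conj_eq intro!: closed_Int)
qed

lemma compactin_closed_unit_ball: "compactin (Euclidean_space n) (closed_unit_ball n)"
proof -
  have "compactin (powertop_real UNIV) (\<Pi>\<^sub>E i\<in>UNIV. {-1..1})"
    by (simp add: compactin_PiE)
  moreover have "closed_unit_ball n \<subseteq> (\<Pi>\<^sub>E i\<in>UNIV. {-1..1})"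
  proof
    fix u assume u: "u \<in> closed_unit_ball n"
    have "\<bar>u i\<bar> \<le> 1" for i
    proof (cases "i < n")
      case True
      have "(u i)\<^sup>2 \<le> (\<Sum>i<n. (u i)\<^sup>2)"
        using True by (intro member_le_sum) auto
      also have "\<dots> \<le> 1"
        using u by (simp add: closed_unit_ball_def)
      finally show ?thesis by (simp add: abs_square_le_1)
    next
      case False
      then show ?thesis
        using u by (simp add: closed_unit_ball_def topspace_Euclidean_space)
    qed
    then show "u \<in> (\<Pi>\<^sub>E i\<in>UNIV. {-1..1})"
      by (auto simp: abs_le_iff)
  qed
  moreover have "closedin (powertop_real UNIV) (closed_unit_ball n)"
    using closedin_closed_unit_ball closedin_Euclidean_imp_closed by (metis closed_closedin euclidean_product_topology)
  ultimately have "compactin (powertop_real UNIV) (closed_unit_ball n)"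
    using closed_compactin by blast
  then show ?thesis
    by (auto simp: Euclidean_space_def compactin_subtopology closed_unit_ball_def)
qed

lemma closed_unit_ball_eq: "closed_unit_ball n = open_unit_ball n \<union> unit_sphere n"
  by (auto simp: closed_unit_ball_def open_unit_ball_def unit_sphere_def)

definition sigma_compactin :: "'a topology \<Rightarrow> 'a set \<Rightarrow> bool" where
  "sigma_compactin X L \<longleftrightarrow> (\<exists>\<C>. countable \<C> \<and> (\<forall>C\<in>\<C>. compactin X C) \<and> L = \<Union>\<C>)"

lemma image_sigma_compactin:
  assumes "sigma_compactin X L" "continuous_map X Y f"
  shows "sigma_compactin Y (f ` L)"
proof -
  obtain \<C> where "countable \<C>" "\<forall>C\<in>\<C>. compactin X C" "L = \<Union>\<C>"
    using assms(1) by (auto simp: sigma_compactin_def)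
  then show ?thesis
    unfolding sigma_compactin_def using assms(2)
    by (intro exI[of _ "image f ` \<C>"]) (auto intro: image_compactin)
qed

lemma sigma_compactin_subset_Union_countable:
  assumes "sigma_compactin X L" "\<And>U. U \<in> \<U> \<Longrightarrow> openin X U" "L \<subseteq> \<Union>\<U>"
  obtains \<V> where "countable \<V>" "\<V> \<subseteq> \<U>" "L \<subseteq> \<Union>\<V>"
proof -
  obtain \<C> where \<C>: "countable \<C>" "\<And>C. C \<in> \<C> \<Longrightarrow> compactin X C" "L = \<Union>\<C>"
    using assms by (auto simp: sigma_compactin_def)
  have "\<exists>\<V>. finite \<V> \<and> \<V> \<subseteq> \<U> \<and> C \<subseteq> \<Union>\<V>" if "C \<in> \<C>" for C
    using compactinD[OF \<C>(2)[OF that], of \<U>] assms \<C> that by blast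
  then obtain V where V: "\<And>C. C \<in> \<C> \<Longrightarrow> finite (V C) \<and> V C \<subseteq> \<U> \<and> C \<subseteq> \<Union>(V C)"
    by metis
  show ?thesis
  proof
    show "countable (\<Union>C\<in>\<C>. V C)"
      using V \<C> by (intro countable_UN) (auto intro: countable_finite)
    show "(\<Union>C\<in>\<C>. V C) \<subseteq> \<U>"
      using V by blast
    show "L \<subseteq> \<Union>(\<Union>C\<in>\<C>. V C)"
    proof
      fix a assume "a \<in> L"
      then obtain C where "C \<in> \<C>" "a \<in> C" using \<C> by auto
      then show "a \<in> \<Union>(\<Union>C\<in>\<C>. V C)" using V[of C] by blast
    qed
  qed
qed

text \<open>A countable set meets countably many cells.  Adding boundary cells again and again, finitely many
  for each cell, yields a countable subcomplex: a union \<open>K\<close> of countably many cells that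
  contains the image of the closed ball of each of its cells, hence is the union of these compact
  images.  It is closed by the weak topology, since any closed cell meets only finitely many
  cells.\<close>

lemma CW_complex_countable_subset_closed_sigma_compact:
  assumes CW: "CW_complex X" and D: "countable D" "D \<subseteq> topspace X"
  obtains K where "closedin X K" "sigma_compactin X K" "D \<subseteq> K"
proof -
  obtain E d \<Phi> where X: "Hausdorff_space X" and str: "CW_structure X E d \<Phi>"
    using CW by (auto simp: CW_complex_def)
  have E: "disjoint E" "\<Union>E = topspace X"
    and \<Phi>: "\<And>e. e \<in> E \<Longrightarrow> continuous_map (subtopology (Euclidean_space (d e)) (closed_unit_ball (d e))) X (\<Phi> e)"
    and hom: "\<And>e. e \<in> E \<Longrightarrow> homeomorphic_map (subtopology (Euclidean_space (d e)) (open_unit_ball (d e))) (subtopology X e) (\<Phi> e)"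
    and weak: "\<And>A. A \<subseteq> topspace X \<Longrightarrow> (\<forall>e\<in>E. closedin X (A \<inter> X closure_of e)) \<Longrightarrow> closedin X A"
    using str unfolding CW_structure_def by simp_all
  have "\<forall>e\<in>E. \<exists>F. finite F \<and> F \<subseteq> {f \<in> E. d f < d e} \<and> \<Phi> e ` unit_sphere (d e) \<subseteq> \<Union>F"
    using str unfolding CW_structure_def by (elim conjE)
  then have "\<exists>F. finite F \<and> F \<subseteq> E \<and> \<Phi> e ` unit_sphere (d e) \<subseteq> \<Union>F" if "e \<in> E" for e
    using that by (metis (no_types, lifting) mem_Collect_eq subset_eq)
  then obtain F where F: "\<And>e. e \<in> E \<Longrightarrow> finite (F e) \<and> F e \<subseteq> E \<and> \<Phi> e ` unit_sphere (d e) \<subseteq> \<Union>(F e)"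
    by metis
  define cl where "cl e = \<Phi> e ` closed_unit_ball (d e)" for e
  have compact_cl: "compactin X (cl e)" if "e \<in> E" for e
    unfolding cl_def
    by (rule image_compactin[OF _ \<Phi>[OF that]])
       (simp add: compactin_subtopology compactin_closed_unit_ball)
  have cell: "\<Phi> e ` open_unit_ball (d e) = e" if "e \<in> E" for e
  proof -
    have "e \<subseteq> topspace X" "open_unit_ball (d e) \<subseteq> topspace (Euclidean_space (d e))"
      using that E by (auto simp: open_unit_ball_def)
    then show ?thesis
      using homeomorphic_imp_surjective_map[OF hom[OF that]] by (simp add: Int_absorb1)
  qed
  have cl: "e \<subseteq> cl e" "cl e \<subseteq> e \<union> \<Union>(F e)" if "e \<in> E" for e
    using cell[OF that] F[OF that] unfolding cl_def closed_unit_ball_eq by auto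
  have closure_cl: "X closure_of e \<subseteq> cl e" if "e \<in> E" for e
    using that cl compact_cl X by (simp add: closure_of_minimal compactin_imp_closedin)
  have "\<exists>C\<subseteq>E. countable C \<and> D \<subseteq> \<Union>C"
  proof -
    have "\<forall>a\<in>D. \<exists>e\<in>E. a \<in> e" using D E by blast
    then obtain h where "\<forall>a\<in>D. h a \<in> E \<and> a \<in> h a" by metis
    then show ?thesis using D by (intro exI[of _ "h ` D"]) auto
  qed
  then obtain C0 where C0: "C0 \<subseteq> E" "countable C0" "D \<subseteq> \<Union>C0" by blast
  \<comment> \<open>Stage \<open>n\<close> has the cells reached from \<open>C0\<close> by passing to boundary cells at most \<open>n\<close> times.\<close>
  define Cn where "Cn n = ((\<lambda>C. C \<union> \<Union>(F ` C)) ^^ n) C0" for n :: nat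
  define C where "C = (\<Union>n. Cn n)"
  have Cn: "Cn n \<subseteq> E \<and> countable (Cn n)" for n
  proof (induction n)
    case 0
    then show ?case using C0 by (simp add: Cn_def)
  next
    case (Suc n)
    have "Cn (Suc n) = Cn n \<union> \<Union>(F ` Cn n)"
      by (simp add: Cn_def)
    moreover have "countable (\<Union>(F ` Cn n))"
      using Suc F by (intro countable_UN) (auto intro: countable_finite)
    moreover have "\<Union>(F ` Cn n) \<subseteq> E"
      using Suc F by blast
    ultimately show ?case using Suc by simp
  qed
  have C: "C \<subseteq> E" "countable C" "D \<subseteq> \<Union>C"
  proof -
    show "C \<subseteq> E" "countable C"
      using Cn by (auto simp: C_def)
    have "C0 = Cn 0" by (simp add: Cn_def)
    then have "C0 \<subseteq> C" by (auto simp: C_def)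
    then show "D \<subseteq> \<Union>C" using C0(3) by blast
  qed
  have FC: "F e \<subseteq> C" if e: "e \<in> C" for e
  proof -
    obtain n where "e \<in> Cn n" using e by (auto simp: C_def)
    then have "F e \<subseteq> Cn (Suc n)" by (auto simp: Cn_def)
    then show ?thesis by (auto simp: C_def)
  qed
  have "cl e \<subseteq> \<Union>C" if "e \<in> C" for e
    using cl(2)[of e] FC[OF that] C that by blast
  moreover have "e \<subseteq> cl e" if "e \<in> C" for e
    using cl(1)[of e] C that by blast
  ultimately have K: "\<Union>C = \<Union>(cl ` C)"
    by blast
  show ?thesis
  proof
    show "sigma_compactin X (\<Union>C)"
      unfolding sigma_compactin_def K using C compact_cl by (intro exI[of _ "cl ` C"]) auto
    show "D \<subseteq> \<Union>C" by (rule C)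
    show "closedin X (\<Union>C)"
    proof (rule weak)
      show "\<Union>C \<subseteq> topspace X" using C E by blast
      show "\<forall>e\<in>E. closedin X (\<Union>C \<inter> X closure_of e)"
      proof
        fix e assume e: "e \<in> E"
        \<comment> \<open>The cells of \<open>K\<close> that can meet the closed cell \<open>e\<close>; there are finitely many.\<close>
        define G where "G = C \<inter> insert e (F e)"
        have "\<Union>C \<inter> X closure_of e \<subseteq> \<Union>(cl ` G)"
        proof
          fix a assume "a \<in> \<Union>C \<inter> X closure_of e"
          then obtain f where f: "f \<in> C" "a \<in> f" "a \<in> cl e"
            using closure_cl e by blast
          then obtain f' where f': "f' \<in> insert e (F e)" "a \<in> f'"
            using cl[OF e] by blast
          then have "f' \<in> E" using e F by blast
          then have "f = f'"
            using f f' C E unfolding disjoint_def by blast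
          then have "f \<in> G" using f f' by (simp add: G_def)
          then show "a \<in> \<Union>(cl ` G)" using f C cl(1)[of f] by blast
        qed
        moreover have "\<Union>(cl ` G) \<subseteq> \<Union>C"
          unfolding K G_def by auto
        ultimately have "\<Union>C \<inter> X closure_of e = \<Union>(cl ` G) \<inter> X closure_of e"
          by blast
        moreover have "closedin X (\<Union>(cl ` G))"
          using F[OF e] C compact_cl X by (intro closedin_Union) (auto simp: G_def intro!: compactin_imp_closedin)
        ultimately show "closedin X (\<Union>C \<inter> X closure_of e)"
          by (simp add: closedin_Int)
      qed
    qed
  qed
qed

text \<open>The subcomplex that carries the image of a countable dense set is closed, so it contains the
  closure of that image.\<close>

lemma continuous_image_separable_in_CW_complex:
  assumes "separable_space S" "CW_complex X" "continuous_map S X f"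
  obtains K where "sigma_compactin X K" "f ` topspace S \<subseteq> K"
proof -
  obtain D where D: "countable D" "D \<subseteq> topspace S" "S closure_of D = topspace S"
    using assms by (auto simp: separable_space_def)
  have "f ` D \<subseteq> topspace X"
    using D assms(3) by (auto simp: continuous_map_def)
  then obtain K where K: "closedin X K" "sigma_compactin X K" "f ` D \<subseteq> K"
    using CW_complex_countable_subset_closed_sigma_compact[OF assms(2)] D by (metis countable_image)
  have "f ` topspace S \<subseteq> X closure_of (f ` D)"
    using continuous_map_image_closure_subset[OF assms(3), of D] D by simp
  also have "\<dots> \<subseteq> K"
    using K by (simp add: closure_of_minimal)
  finally show ?thesis using K that by blast
qed

text \<open>The winding number of a loop in the punctured plane is a homotopy invariant, phrased by means
  of the increment of a logarithm.  The square carries a logarithm \<open>L\<close>; any logarithm on a side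
  \<open>s = 0\<close> or \<open>s = 1\<close> differs from \<open>L\<close> by a constant, and the increment of \<open>L\<close> along the
  loop at time \<open>s\<close> is continuous in \<open>s\<close> with values in the discrete set of periods of
  \<open>exp\<close>.\<close>

lemma log_increment_homotopy_invariant:
  fixes Q :: "real \<times> real \<Rightarrow> complex"
  assumes cont: "continuous_on ({0..1} \<times> {-1..1}) Q"
    and nz: "\<And>w. w \<in> {0..1} \<times> {-1..1} \<Longrightarrow> Q w \<noteq> 0"
    and loop: "\<And>s. s \<in> {0..1} \<Longrightarrow> Q (s, 1) = Q (s, -1)"
    and l0: "continuous_on {-1..1} l0" "\<And>t. t \<in> {-1..1} \<Longrightarrow> Q (0, t) = exp (l0 t)"
    and l1: "continuous_on {-1..1} l1" "\<And>t. t \<in> {-1..1} \<Longrightarrow> Q (1, t) = exp (l1 t)"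
  shows "l0 1 - l0 (-1) = l1 1 - l1 (-1)"
proof -
  obtain L where L: "continuous_on ({0..1} \<times> {-1..1}) L" "\<And>w. w \<in> {0..1} \<times> {-1..1} \<Longrightarrow> Q w = exp (L w)"
    using continuous_logarithm_on_contractible[OF cont _ nz]
    by (metis convex_Times convex_imp_contractible convex_real_interval(5))
  have const: "g a = g b"
    if cg: "continuous_on {p..q} g" and g: "\<And>u. u \<in> {p..q} \<Longrightarrow> exp (g u) = 1" and ab: "a \<in> {p..q}" "b \<in> {p..q}"
    for g :: "real \<Rightarrow> complex" and p q a b
  proof -
    have "g constant_on {p..q}"
    proof (rule continuous_discrete_range_constant)
      fix u assume u: "u \<in> {p..q}"
      have "2 * pi \<le> norm (g v - g u)" if v: "v \<in> {p..q}" "g v \<noteq> g u" for v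
      proof (rule ccontr)
        assume "\<not> 2 * pi \<le> norm (g v - g u)"
        then have "\<bar>Im (g v) - Im (g u)\<bar> < 2 * pi"
          using abs_Im_le_cmod[of "g v - g u"] by simp
        moreover have "exp (g v) = exp (g u)"
          using u v g by simp
        ultimately show False
          using exp_complex_eqI v by blast
      qed
      then show "\<exists>e>0. \<forall>v. v \<in> {p..q} \<and> g v \<noteq> g u \<longrightarrow> e \<le> norm (g v - g u)"
        by (intro exI[of _ "2 * pi"]) auto
    qed (use cg in auto)
    then show ?thesis using ab by (auto simp: constant_on_def)
  qed
  have side: "l 1 - l (-1) = L (s, 1) - L (s, -1)"
    if "s \<in> {0..1}" "continuous_on {-1..1} l" "\<And>t. t \<in> {-1..1} \<Longrightarrow> Q (s, t) = exp (l t)" for s l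
  proof -
    have "continuous_on {-1..1} (\<lambda>t. l t - L (s, t))"
      using that by (intro continuous_intros continuous_on_compose2[OF L(1)]) auto
    moreover have "exp (l t - L (s, t)) = 1" if "t \<in> {-1..1}" for t
      using that \<open>s \<in> {0..1}\<close> L(2)[of "(s, t)"] \<open>\<And>t. t \<in> {-1..1} \<Longrightarrow> Q (s, t) = exp (l t)\<close>
      by (auto simp: exp_diff)
    ultimately have "l 1 - L (s, 1) = l (-1) - L (s, -1)"
      by (rule const[where p = "-1" and q = 1]) auto
    then show ?thesis by (simp add: algebra_simps)
  qed
  have "continuous_on {0..1} (\<lambda>s. L (s, 1) - L (s, -1))"
    by (intro continuous_intros continuous_on_compose2[OF L(1)]) auto
  moreover have "exp (L (s, 1) - L (s, -1)) = 1" if "s \<in> {0..1}" for s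
    using that loop L(2)[of "(s, 1)"] L(2)[of "(s, -1)"] by (auto simp: exp_diff)
  ultimately have "L (0, 1) - L (0, -1) = L (1, 1) - L (1, -1)"
    by (rule const[where p = 0 and q = 1]) auto
  then show ?thesis
    using side[of 0 l0] side[of 1 l1] l0 l1 by auto
qed

section \<open>No deformation into a sigma-compact set\<close>

lemma sigma_compact_subset_countably_many_charts:
  assumes "sigma_compactin pruefer_surface L"
  obtains Y where "countable Y" "L \<subseteq> (\<Union>y\<in>Y. range (chart y))"
proof -
  have "L \<subseteq> topspace pruefer_surface"
    using assms compactin_subset_topspace by (fastforce simp: sigma_compactin_def)
  then have "L \<subseteq> \<Union>(range (\<lambda>y. range (chart y)))"
    using Union_charts by simp
  then obtain \<V> where \<V>: "countable \<V>" "\<V> \<subseteq> range (\<lambda>y. range (chart y))" "L \<subseteq> \<Union>\<V>"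
    by (rule sigma_compactin_subset_Union_countable[OF assms, rotated]) (auto intro: openin_chart_image)
  then obtain Y where "countable Y" "\<V> = (\<lambda>y. range (chart y)) ` Y"
    by (metis countable_subset_image)
  then show ?thesis using that \<V> by blast
qed

text \<open>A sigma-compact set lies in countably many charts, so it misses some bridge, at \<open>x\<close> say.
  The loop that goes up through the bridge at \<open>x\<close> and down through the bridge at \<open>x + 1\<close> has
  winding number of absolute value one under \<open>bridge_phase x\<close>.  After the deformation the winding
  number is zero, because \<open>bridge_phase x\<close> has a continuous real argument on the image of \<open>r\<close>.

  The loop is described by two paths \<open>\<gamma>\<close> and \<open>\<gamma>'\<close> with common endpoints, one for each bridge.
  The quotient \<open>Q\<close> of the values of \<open>bridge_phase x\<close> along the deformed paths is then a homotopy of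
  loops in the punctured plane based at \<open>1\<close>, which avoids concatenating paths.\<close>

lemma id_not_homotopic_into_sigma_compact:
  assumes L: "sigma_compactin pruefer_surface L" and rL: "r ` topspace pruefer_surface \<subseteq> L"
  shows "\<not> homotopic_with (\<lambda>_. True) pruefer_surface pruefer_surface id r"
proof
  assume "homotopic_with (\<lambda>_. True) pruefer_surface pruefer_surface id r"
  then obtain H where H: "continuous_map (prod_topology (top_of_set {0..1::real}) pruefer_surface) pruefer_surface H"
    and H01: "\<forall>c. H (0, c) = id c" "\<forall>c. H (1, c) = r c"
    unfolding homotopic_with_def by (elim exE conjE)
  have H0: "H (0, c) = c" and H1: "H (1, c) = r c" for c
    using H01 by (auto simp only: id_apply)
  have r: "continuous_map pruefer_surface pruefer_surface r"
    using \<open>homotopic_with _ _ _ id r\<close> by (auto dest: homotopic_with_imp_continuous_maps)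
  obtain Y where Y: "countable Y" "L \<subseteq> (\<Union>y\<in>Y. range (chart y))"
    using sigma_compact_subset_countably_many_charts[OF L] .
  obtain x where x: "x \<notin> Y"
    using Y uncountable_UNIV_real by (metis UNIV_eq_I)
  \<comment> \<open>The slope \<open>-1\<close> makes the second path start and end at the points of height one above \<open>x\<close>.\<close>
  define \<gamma> \<gamma>' where "\<gamma> = (\<lambda>t. chart x (0, t))" and "\<gamma>' = (\<lambda>t. chart (x + 1) (-1, t))"
  have ends: "\<gamma> t = \<gamma>' t" if "t \<in> {-1, 1}" for t
    using that by (auto simp: \<gamma>_def \<gamma>'_def chart_eq_iff)
  have path: "continuous_map euclideanreal pruefer_surface \<gamma>" "continuous_map euclideanreal pruefer_surface \<gamma>'"
    unfolding \<gamma>_def \<gamma>'_def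
    by (auto intro!: continuous_map_compose[OF _ continuous_map_chart, unfolded o_def] continuous_intros)
  have square: "continuous_on ({0..1} \<times> {-1..1}) (\<lambda>w. bridge_phase x (H (fst w, \<delta> (snd w))))"
    if \<delta>: "continuous_map euclideanreal pruefer_surface \<delta>" for \<delta>
  proof -
    let ?D = "top_of_set ({0..1::real} \<times> {-1..1::real})"
    have "continuous_map ?D (prod_topology (top_of_set {0..1}) pruefer_surface) (\<lambda>w. (fst w, \<delta> (snd w)))"
    proof (intro continuous_map_pairedI)
      show "continuous_map ?D (top_of_set {0..1}) fst"
        unfolding continuous_map_in_subtopology
        by (intro conjI) (auto intro!: continuous_on_fst continuous_on_id)
      have "continuous_map ?D euclideanreal snd"
        by (simp add: continuous_on_snd continuous_on_id)
      then show "continuous_map ?D pruefer_surface (\<lambda>w. \<delta> (snd w))"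
        by (rule continuous_map_compose[OF _ \<delta>, unfolded o_def])
    qed
    then have "continuous_map ?D euclidean (bridge_phase x \<circ> (H \<circ> (\<lambda>w. (fst w, \<delta> (snd w)))))"
      by (intro continuous_map_compose[OF _ continuous_bridge_phase] continuous_map_compose[OF _ H])
    then show ?thesis by (simp add: o_def)
  qed
  have nz: "bridge_phase x c \<noteq> 0" for c
    by (simp add: bridge_phase_def)
  have pushed: "continuous_on {-1..1} (\<lambda>t. signed_height x (r (\<delta> t)))"
    "bridge_phase x (r (\<delta> t)) = cis (2 * arctan (signed_height x (r (\<delta> t))))"
    if \<delta>: "continuous_map euclideanreal pruefer_surface \<delta>" for \<delta> t
  proof -
    have "continuous_map euclideanreal pruefer_surface (r \<circ> \<delta>)"
      by (rule continuous_map_compose[OF \<delta> r])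
    moreover have im: "r (\<delta> t) \<in> (\<Union>y\<in>Y. range (chart y))" for t
    proof -
      have "\<delta> t \<in> topspace pruefer_surface"
        using continuous_map_funspace[OF \<delta>] by (simp add: Pi_iff)
      then show ?thesis using rL Y by blast
    qed
    ultimately have "continuous_map euclideanreal (subtopology pruefer_surface (\<Union>y\<in>Y. range (chart y))) (r \<circ> \<delta>)"
      by (auto simp: continuous_map_in_subtopology)
    then have "continuous_map euclideanreal euclideanreal (signed_height x \<circ> (r \<circ> \<delta>))"
      by (rule continuous_map_compose[OF _ continuous_signed_height[OF x]])
    then show "continuous_on {-1..1} (\<lambda>t. signed_height x (r (\<delta> t)))"
      using continuous_on_subset by (auto simp: o_def)
    show "bridge_phase x (r (\<delta> t)) = cis (2 * arctan (signed_height x (r (\<delta> t))))"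
      using bridge_phase_eq_cis[OF x im] .
  qed
  define Q where "Q w = bridge_phase x (H (fst w, \<gamma> (snd w))) / bridge_phase x (H (fst w, \<gamma>' (snd w)))" for w
  \<comment> \<open>Arguments of \<open>Q\<close> on the two sides of the square: before the deformation from
    the chart formulas, after it from the signed height.\<close>
  define \<theta>0 where "\<theta>0 t = pi - 2 * arctan t - 2 * arctan (t / ((1 - \<bar>t\<bar>)\<^sup>2 + t\<^sup>2))" for t
  define \<theta>1 where "\<theta>1 t = 2 * arctan (signed_height x (r (\<gamma> t))) - 2 * arctan (signed_height x (r (\<gamma>' t)))" for t
  have "\<i> * of_real (\<theta>0 1) - \<i> * of_real (\<theta>0 (-1)) = \<i> * of_real (\<theta>1 1) - \<i> * of_real (\<theta>1 (-1))"
  proof (rule log_increment_homotopy_invariant[of Q])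
    show "continuous_on ({0..1} \<times> {-1..1}) Q"
      unfolding Q_def by (intro continuous_intros square path) (simp add: nz)
    show "Q w \<noteq> 0" for w
      by (simp add: Q_def nz)
    show "Q (s, 1) = Q (s, -1)" for s
      using ends by (simp add: Q_def nz)
    have den: "(1 - \<bar>t\<bar>)\<^sup>2 + t\<^sup>2 \<noteq> 0" for t :: real
      by (auto simp: sum_power2_eq_zero_iff)
    then show "continuous_on {-1..1} (\<lambda>t. \<i> * of_real (\<theta>0 t))"
      unfolding \<theta>0_def by (intro continuous_intros) auto
    show "continuous_on {-1..1} (\<lambda>t. \<i> * of_real (\<theta>1 t))"
      unfolding \<theta>1_def by (intro continuous_intros pushed path)
    show "Q (1, t) = exp (\<i> * of_real (\<theta>1 t))" for t
      unfolding cis_conv_exp[symmetric] by (simp add: Q_def H1 pushed path \<theta>1_def cis_divide)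
    have "bridge_phase x (\<gamma> t) = cis (pi - 2 * arctan t)" for t
      by (simp add: \<gamma>_def bridge_phase_own_chart cis_mult[of pi, symmetric] diff_conv_add_uminus del: add_uminus_conv_diff)
    moreover have "bridge_phase x (\<gamma>' t) = cis (2 * arctan (t / ((1 - \<bar>t\<bar>)\<^sup>2 + t\<^sup>2)))" for t
      by (simp add: \<gamma>'_def bridge_phase_other_chart)
    ultimately show "Q (0, t) = exp (\<i> * of_real (\<theta>0 t))" for t
      unfolding cis_conv_exp[symmetric] by (simp add: Q_def H0 \<theta>0_def cis_divide)
  qed
  moreover have "\<theta>1 1 = 0" "\<theta>1 (-1) = 0"
    using ends by (simp_all add: \<theta>1_def)
  \<comment> \<open>The undeformed loop makes a full turn.\<close>
  moreover have "\<theta>0 1 = 0" "\<theta>0 (-1) = 2 * pi"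
    by (simp_all add: \<theta>0_def arctan_one arctan_minus)
  ultimately show False by simp
qed

theorem theorem1p1:
  shows "topological_manifold 2 pruefer_surface \<and>
         separable_space pruefer_surface \<and>
         \<not> metrizable_space pruefer_surface \<and>
         \<not> (\<exists>X :: 'b topology. CW_complex X \<and> pruefer_surface homotopy_equivalent_space X)"
proof (intro conjI notI)
  show "topological_manifold 2 pruefer_surface"
    by (simp add: topological_manifold_def Hausdorff_pruefer_surface locally_Euclidean_pruefer_surface)
  show "separable_space pruefer_surface"
    by (rule separable_pruefer_surface)
  show False if "metrizable_space pruefer_surface"
    using that not_metrizable_pruefer_surface by blast
  assume "\<exists>X :: 'b topology. CW_complex X \<and> pruefer_surface homotopy_equivalent_space X"
  then obtain X :: "'b topology" and f g where X: "CW_complex X"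
    and f: "continuous_map pruefer_surface X f" and g: "continuous_map X pruefer_surface g"
    and gf: "homotopic_with (\<lambda>_. True) pruefer_surface pruefer_surface (g \<circ> f) id"
    unfolding homotopy_equivalent_space_def by blast
  obtain K where K: "sigma_compactin X K" "f ` topspace pruefer_surface \<subseteq> K"
    using continuous_image_separable_in_CW_complex[OF separable_pruefer_surface X f] .
  have "sigma_compactin pruefer_surface (g ` K)"
    using image_sigma_compactin[OF K(1) g] .
  moreover have "(g \<circ> f) ` topspace pruefer_surface \<subseteq> g ` K"
    using K(2) by auto
  ultimately show False
    using id_not_homotopic_into_sigma_compact[of "g ` K" "g \<circ> f"] homotopic_with_symD[OF gf] by simp
qed

end
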